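(* Let $D \subset \mathbb{R}^m$, $m \geq 2$, be a bounded domain, let $\mu > 0$, and let $u \in C^0(D)$. For $x \in D$ and $0 < r_1 < r_2$ put $A_x(r_1,r_2) = \{ y \in \mathbb{R}^m : r_1 < |x-y| < r_2 \}$, and call $B_{r_2}(x) = \{y : |y-x|<r_2\}$ admissible if $\overline{B_{r_2}(x)} \subset D$. Suppose that $$\frac{1}{|A_x(r_1,r_2)|}\int_{A_x(r_1,r_2)} u(y)\,\mathrm{d}y \;=\; \frac{a^\bullet(\mu r_2)\,|B_{r_2}(x)| - a^\bullet(\mu r_1)\,|B_{r_1}(x)|}{a^\circ(\mu r)\,|A_x(r_1,r_2)|}\cdot \frac{1}{\omega_m r^{m-1}} \int_{S_r(x)} u(y)\,\mathrm{d}S_y$$ holds for every $x \in D$ and every $r_2 > r_1 > 0$ such that $B_{r_2}(x)$ is admissible, where $S_r(x)=\{y:|y-x|=r\}$ and $r$ is subject to one of the following: either the identity holds for every $r \in (r_1,r_2)$, or it holds with $r = r_1$, or it holds with $r = r_2$. Then $u$ is $\mu$-panharmonic in $D$.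
   Context: $|A|$ denotes volume, $\mathrm{d}S$ surface measure, $\omega_m = 2\pi^{m/2}/\Gamma(m/2)$. The coefficients are $a^\circ(t) = \Gamma(m/2)\, I_{(m-2)/2}(t)/(t/2)^{(m-2)/2}$ and $a^\bullet(t) = \Gamma(m/2+1)\, I_{m/2}(t)/(t/2)^{m/2}$, where $I_\nu$ is the modified Bessel function of order $\nu$. A function is $\mu$-panharmonic in $D$ if it is a real-valued $C^2(D)$ solution of $\nabla^2 u - \mu^2 u = 0$ in $D$. *)

theory Defs
  imports "HOL-Analysis.Analysis"
begin

(* Modified Bessel function of the first kind, via its power series (t > 0). *)
definition besselI :: "real \<Rightarrow> real \<Rightarrow> real" where
  "besselI \<nu> t = (\<Sum>k. (t / 2) powr (2 * real k + \<nu>) / (fact k * Gamma (real k + \<nu> + 1)))"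

definition a_circ :: "nat \<Rightarrow> real \<Rightarrow> real" where
  "a_circ m t = Gamma (real m / 2) * besselI ((real m - 2) / 2) t / (t / 2) powr ((real m - 2) / 2)"

definition a_bullet :: "nat \<Rightarrow> real \<Rightarrow> real" where
  "a_bullet m t = Gamma (real m / 2 + 1) * besselI (real m / 2) t / (t / 2) powr (real m / 2)"

(* omega_m = 2 pi^(m/2) / Gamma(m/2), the area of the unit sphere *)
definition omega :: "nat \<Rightarrow> real" where
  "omega m = 2 * pi powr (real m / 2) / Gamma (real m / 2)"

definition annulus :: "'a::euclidean_space \<Rightarrow> real \<Rightarrow> real \<Rightarrow> 'a set" where
  "annulus x r1 r2 = {y. r1 < dist x y \<and> dist x y < r2}"

(* Surface measure on the sphere S_r(x), defined as the (scaled) cone measure: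
   sigma(E) = DIM * r^(DIM-1) * |{y in B_1(0)\{0} : x + r y/|y| in E}| . *)
definition surface_measure :: "'a::euclidean_space \<Rightarrow> real \<Rightarrow> 'a measure" where
  "surface_measure x r =
     scale_measure (ennreal (real DIM('a) * r ^ (DIM('a) - 1)))
       (distr (restrict_space lborel (ball 0 1 - {0})) (restrict_space borel (sphere x r))
          (\<lambda>y. x + r *\<^sub>R (y /\<^sub>R norm y)))"

definition sphere_integral :: "('a::euclidean_space \<Rightarrow> real) \<Rightarrow> 'a \<Rightarrow> real \<Rightarrow> real" where
  "sphere_integral u x r = integral\<^sup>L (surface_measure x r) u"

definition partial :: "'a::euclidean_space \<Rightarrow> ('a \<Rightarrow> real) \<Rightarrow> 'a \<Rightarrow> real" where
  "partial i f x = deriv (\<lambda>t. f (x + t *\<^sub>R i)) 0"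

definition has_partial_on :: "'a::euclidean_space \<Rightarrow> ('a \<Rightarrow> real) \<Rightarrow> 'a set \<Rightarrow> bool" where
  "has_partial_on i f D \<longleftrightarrow> (\<forall>x\<in>D. (\<lambda>t. f (x + t *\<^sub>R i)) field_differentiable (at 0))"

definition C2_on :: "'a::euclidean_space set \<Rightarrow> ('a \<Rightarrow> real) \<Rightarrow> bool" where
  "C2_on D f \<longleftrightarrow> continuous_on D f \<and>
     (\<forall>i\<in>Basis. has_partial_on i f D \<and> continuous_on D (partial i f) \<and>
        (\<forall>j\<in>Basis. has_partial_on j (partial i f) D \<and> continuous_on D (partial j (partial i f))))"

definition laplacian :: "('a::euclidean_space \<Rightarrow> real) \<Rightarrow> 'a \<Rightarrow> real" where
  "laplacian f x = (\<Sum>i\<in>Basis. partial i (partial i f) x)"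

definition panharmonic :: "real \<Rightarrow> 'a::euclidean_space set \<Rightarrow> ('a \<Rightarrow> real) \<Rightarrow> bool" where
  "panharmonic \<mu> D u \<longleftrightarrow> C2_on D u \<and> (\<forall>x\<in>D. laplacian u x - \<mu>^2 * u x = 0)"

definition MV_identity :: "real \<Rightarrow> ('a::euclidean_space \<Rightarrow> real) \<Rightarrow> 'a \<Rightarrow> real \<Rightarrow> real \<Rightarrow> real \<Rightarrow> bool" where
  "MV_identity \<mu> u x r1 r2 r \<longleftrightarrow>
     (LINT y:annulus x r1 r2|lborel. u y) / measure lborel (annulus x r1 r2)
     = (a_bullet DIM('a) (\<mu> * r2) * measure lborel (ball x r2)
          - a_bullet DIM('a) (\<mu> * r1) * measure lborel (ball x r1))
       / (a_circ DIM('a) (\<mu> * r) * measure lborel (annulus x r1 r2))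
       * (1 / (omega DIM('a) * r ^ (DIM('a) - 1))) * sphere_integral u x r"

end

(* Letting r1 tend to 0 turns each of the three hypotheses into the volume mean value property
   int_{B_s(x)} u = a_bullet(mu s) |B_s| u(x). Slicing a radial kernel k(|y - x|) into balls, one finds
   that the convolution of u with k is a constant multiple of u. For k = (R^2 - |z|^2)_+^3 this makes u
   of class C^2 near each point. The Laplacian of k is again radial and vanishes at |z| = R, so
   Delta u too is a constant multiple of u, and the modified Bessel equation identifies the
   constant as mu^2. *)

theory Submission
  imports Defs
begin

text \<open>Only continuity of u is known, so all derivatives have to fall on a kernel. In the
  background stands the radial solution U(s) = \<open>hyp01 (m / 2) ((\<mu> * s / 2)^2)\<close> with
  U(0) = 1. Its integral over a ball of radius s is \<open>a_bullet m (\<mu> * s)\<close> times the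
  volume, so the mean value property says that u has the same integrals over balls about x as u(x)
  U(|y - x|). Hence a radial kernel acts on u at x as it acts on U at 0, times u(x), and Green's
  identity for the kernel and U predicts the factor \<mu>^2 between the constants for its Laplacian
  and for the kernel itself. A power of R^2 - |z|^2 is convenient because its radial profile and
  that of its Laplacian are polynomials, so the prediction can be checked by an explicit
  antiderivative. The profile is also strictly decreasing on (0, R), which makes the constant for
  the kernel positive, so that it can be divided by. Slicing into balls takes only Fubini's theorem,
  and the only analytic fact about sphere means is their limit at radius 0.\<close>

section \<open>The Bessel coefficients\<close>

text \<open>The confluent hypergeometric limit function \<open>\<^sub>0F\<^sub>1(;q;w)\<close>: both coefficients are of this form,
  with \<open>w = (t/2)\<^sup>2\<close>, and unlike their defining expressions it is smooth at 0.\<close>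

definition hyp01 :: "real \<Rightarrow> real \<Rightarrow> real" where
  "hyp01 q w = (\<Sum>k. w ^ k / (fact k * pochhammer q k))"

text \<open>Serves to dominate the series of \<open>hyp01\<close> by the exponential series and to
  make its terms nonnegative for \<open>w \<ge> 0\<close>.\<close>

lemma pochhammer_ge_1:
  fixes q :: real
  assumes "q \<ge> 1"
  shows "pochhammer q k \<ge> 1"
proof (induction k)
  case (Suc k)
  have "1 * 1 \<le> pochhammer q k * (q + real k)"
    using Suc assms by (intro mult_mono) auto
  then show ?case by (simp add: pochhammer_Suc)
qed simp

lemma summable_hyp01:
  fixes q w :: real
  assumes "q \<ge> 1"
  shows "summable (\<lambda>k. w ^ k / (fact k * pochhammer q k))"
proof (rule summable_comparison_test)
  show "summable (\<lambda>k. inverse (fact k) * \<bar>w\<bar> ^ k)"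
    by (rule summable_exp)
  show "\<exists>N. \<forall>k\<ge>N. norm (w ^ k / (fact k * pochhammer q k)) \<le> inverse (fact k) * \<bar>w\<bar> ^ k"
  proof (intro exI allI impI)
    fix k :: nat
    have p: "pochhammer q k \<ge> 1"
      by (rule pochhammer_ge_1[OF assms])
    have "norm (w ^ k / (fact k * pochhammer q k)) = \<bar>w\<bar> ^ k / (fact k * pochhammer q k)"
      using p by (simp add: abs_mult power_abs)
    also have "\<dots> \<le> \<bar>w\<bar> ^ k / (fact k * 1)"
      using p by (intro divide_left_mono mult_left_mono) auto
    finally show "norm (w ^ k / (fact k * pochhammer q k)) \<le> inverse (fact k) * \<bar>w\<bar> ^ k"
      by (simp add: field_simps)
  qed
qed

lemma hyp01_0 [simp]: "hyp01 q 0 = 1"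
  using suminf_finite[of "{0}" "\<lambda>k. 0 ^ k / (fact k * pochhammer q k)"]
  by (simp add: hyp01_def)

lemma hyp01_pos:
  assumes "q \<ge> 1" "w \<ge> 0"
  shows "hyp01 q w > 0"
  unfolding hyp01_def
proof (rule suminf_pos2[where i = 0])
  show "0 \<le> w ^ k / (fact k * pochhammer q k)" for k
    using assms pochhammer_ge_1[OF assms(1), of k] by simp
qed (use summable_hyp01[OF assms(1)] in auto)

text \<open>Termwise differentiation only shifts the parameter, because
  \<open>pochhammer q (Suc k) = q * pochhammer (q + 1) k\<close>.\<close>

lemma DERIV_hyp01:
  assumes "q \<ge> 1"
  shows "(hyp01 q has_real_derivative hyp01 (q + 1) w / q) (at w)"
proof -
  define c where "c k = 1 / (fact k * pochhammer q k)" for k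
  have h: "hyp01 q = (\<lambda>w. \<Sum>k. c k * w ^ k)"
    by (simp add: hyp01_def c_def fun_eq_iff)
  have "diffs c k = 1 / (fact k * pochhammer (q + 1) k) / q" for k
    using assms by (simp add: diffs_def c_def pochhammer_rec field_simps del: of_nat_Suc)
  then have "(\<Sum>k. diffs c k * w ^ k) = (\<Sum>k. w ^ k / (fact k * pochhammer (q + 1) k) / q)"
    by (simp add: field_simps)
  also have "\<dots> = hyp01 (q + 1) w / q"
    unfolding hyp01_def using assms by (intro suminf_divide summable_hyp01) auto
  finally have "(\<Sum>k. diffs c k * w ^ k) = hyp01 (q + 1) w / q" .
  moreover have "summable (\<lambda>k. c k * y ^ k)" for y
    using summable_hyp01[OF assms, of y] by (simp add: c_def)
  ultimately show ?thesis
    unfolding h using termdiffs_strong_converges_everywhere[of c w] by simp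
qed

lemma continuous_hyp01 [continuous_intros]:
  assumes "q \<ge> 1" "continuous_on S f"
  shows "continuous_on S (\<lambda>x. hyp01 q (f x))"
proof -
  have "continuous_on UNIV (hyp01 q)"
    using DERIV_hyp01[OF assms(1)] by (meson DERIV_isCont continuous_at_imp_continuous_on)
  from continuous_on_compose2[OF this assms(2)] show ?thesis by simp
qed

text \<open>The difference of the terms of index k with parameters q and q + 1 carries a factor k,
  which cancels against the factorial; shifting the index gives the last series. Read through
  \<open>DERIV_hyp01\<close>, this is the differential equation w f'' + q f' = f for f =
  \<open>hyp01 q\<close>, a form of Bessel's equation.\<close>

lemma hyp01_contiguous:
  assumes "q \<ge> 1"
  shows "hyp01 q w = hyp01 (q + 1) w + w / (q * (q + 1)) * hyp01 (q + 2) w"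
proof -
  define d where "d k = w ^ k / (fact k * pochhammer q k) - w ^ k / (fact k * pochhammer (q + 1) k)" for k
  have s: "summable d"
    unfolding d_def using assms by (intro summable_diff summable_hyp01) auto
  have "d (Suc k) = w / (q * (q + 1)) * (w ^ k / (fact k * pochhammer (q + 2) k))" for k
  proof -
    define P where "P = pochhammer (q + 1) k"
    have P: "P > 0" using pochhammer_ge_1[of "q + 1" k] assms by (simp add: P_def)
    have 1: "pochhammer q (Suc k) = q * P" by (simp add: P_def pochhammer_rec)
    have 2: "pochhammer (q + 1) (Suc k) = P * (q + 1 + real k)" by (simp add: P_def pochhammer_Suc)
    have 3: "pochhammer (q + 2) k = P * (q + 1 + real k) / (q + 1)"
      using 2 assms by (simp add: pochhammer_rec field_simps)
    have f: "fact (Suc k) = (1 + real k) * fact k" by simp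
    show ?thesis
      unfolding d_def 1 2 3 f using assms P 
      by (simp add: divide_simps add_pos_nonneg add_nonneg_eq_0_iff) (simp add: algebra_simps)
  qed
  then have "(\<Sum>k. d (Suc k)) = (\<Sum>k. w / (q * (q + 1)) * (w ^ k / (fact k * pochhammer (q + 2) k)))"
    by (simp only:)
  also have "\<dots> = w / (q * (q + 1)) * hyp01 (q + 2) w"
    unfolding hyp01_def using assms by (intro suminf_mult summable_hyp01) auto
  finally have "(\<Sum>k. d (Suc k)) = w / (q * (q + 1)) * hyp01 (q + 2) w" .
  moreover have "suminf d = hyp01 q w - hyp01 (q + 1) w"
    unfolding d_def hyp01_def using assms by (intro suminf_diff[symmetric] summable_hyp01) auto
  moreover have "d 0 = 0" by (simp add: d_def)
  ultimately show ?thesis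
    using suminf_split_head[OF s] by simp
qed

text \<open>The power \<open>(t / 2) powr \<nu>\<close> is common to all terms, and the quotient of
  the Gamma values in a term by \<open>Gamma (\<nu> + 1)\<close> is a Pochhammer symbol. The
  constant C collects what is common.\<close>

lemma besselI_hyp01:
  assumes "\<nu> \<ge> 0" "t > 0"
  shows "Gamma (\<nu> + 1) * besselI \<nu> t / (t / 2) powr \<nu> = hyp01 (\<nu> + 1) ((t / 2)\<^sup>2)"
proof -
  define C where "C = Gamma (\<nu> + 1) / (t / 2) powr \<nu>"
  have C: "C > 0"
    unfolding C_def using assms by (intro divide_pos_pos Gamma_real_pos) auto
  have *: "(t / 2) powr (2 * real k + \<nu>) / (fact k * Gamma (real k + \<nu> + 1)) =
    ((t / 2)\<^sup>2) ^ k / (fact k * pochhammer (\<nu> + 1) k) / C" for k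
  proof -
    have "(t / 2) powr (2 * real k + \<nu>) = (t / 2) ^ (2 * k) * (t / 2) powr \<nu>"
      using assms powr_realpow[of "t/2" "2 * k"] by (simp add: powr_add)
    moreover have "pochhammer (\<nu> + 1) k = Gamma (real k + \<nu> + 1) / Gamma (\<nu> + 1)"
      using assms by (subst pochhammer_Gamma) (auto simp: add_ac)
    moreover have "Gamma (\<nu> + 1) \<noteq> 0"
      using Gamma_real_pos[of "\<nu> + 1"] assms by linarith
    ultimately show ?thesis
      using assms by (simp add: C_def power_mult)
  qed
  have "besselI \<nu> t = hyp01 (\<nu> + 1) ((t / 2)\<^sup>2) / C"
    unfolding besselI_def hyp01_def *
    using assms by (intro suminf_divide summable_hyp01) auto
  moreover have "Gamma (\<nu> + 1) * besselI \<nu> t / (t / 2) powr \<nu> = C * besselI \<nu> t"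
    by (simp add: C_def)
  ultimately show ?thesis using C by simp
qed

lemma a_bullet_hyp01:
  assumes "t > 0"
  shows "a_bullet m t = hyp01 (real m / 2 + 1) ((t / 2)\<^sup>2)"
  using besselI_hyp01[of "real m / 2" t] assms by (simp add: a_bullet_def)

lemma a_circ_hyp01:
  assumes "t > 0" "m \<ge> 2"
  shows "a_circ m t = hyp01 (real m / 2) ((t / 2)\<^sup>2)"
  using besselI_hyp01[of "(real m - 2) / 2" t] assms by (simp add: a_circ_def diff_divide_distrib)

section \<open>Mean values over spheres and balls\<close>

definition sphere_mean :: "('a::euclidean_space \<Rightarrow> real) \<Rightarrow> 'a \<Rightarrow> real \<Rightarrow> real" where
  "sphere_mean u x r = 1 / (omega DIM('a) * r ^ (DIM('a) - 1)) * sphere_integral u x r"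

lemma scale_measure_eq_density: "scale_measure c M = density M (\<lambda>_. c)"
  by (rule measure_eqI) (simp_all add: emeasure_density_const)

text \<open>Undoes the cone construction: the integral is pulled back along the radial projection of
  the punctured unit ball. Continuity of u on the sphere supplies measurability for the restricted
  Borel algebra.\<close>

lemma sphere_integral_eq:
  fixes x :: "'a::euclidean_space"
  assumes "r > 0" and u: "continuous_on (sphere x r) u"
  shows "sphere_integral u x r = real DIM('a) * r ^ (DIM('a) - 1) *
    (LINT y:ball 0 1 - {0}|lborel. u (x + r *\<^sub>R (y /\<^sub>R norm y)))"
proof -
  let ?M = "restrict_space lborel (ball 0 1 - {0}) :: 'a measure"
  let ?N = "restrict_space borel (sphere x r)"
  let ?p = "\<lambda>y. x + r *\<^sub>R (y /\<^sub>R norm y)"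
  have p: "?p \<in> measurable ?M ?N"
  proof (rule measurable_restrict_space2)
    show "?p \<in> space ?M \<rightarrow> sphere x r"
      using assms by (auto simp: space_restrict_space dist_norm)
    have "continuous_on (ball 0 1 - {0}) ?p"
      by (intro continuous_intros) auto
    then show "?p \<in> borel_measurable ?M"
      using borel_measurable_continuous_on_restrict
      by (simp add: measurable_def space_restrict_space sets_restrict_space)
  qed
  have u': "u \<in> borel_measurable ?N"
    using u by (rule borel_measurable_continuous_on_restrict)
  have "sphere_integral u x r = real DIM('a) * r ^ (DIM('a) - 1) * integral\<^sup>L (distr ?M ?N ?p) u"
    unfolding sphere_integral_def surface_measure_def scale_measure_eq_density
    using u' \<open>r > 0\<close> by (subst integral_density) auto
  also have "integral\<^sup>L (distr ?M ?N ?p) u = integral\<^sup>L ?M (\<lambda>y. u (?p y))"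
    by (rule integral_distr[OF p u'])
  also have "\<dots> = (LINT y:ball 0 1 - {0}|lborel. u (?p y))"
    unfolding set_lebesgue_integral_def by (rule integral_restrict_space) auto
  finally show ?thesis .
qed

text \<open>The normalising factor in \<open>sphere_mean\<close> is therefore the total mass of the
  cone measure, so that \<open>sphere_mean\<close> is a true average.\<close>

lemma omega_eq: "omega DIM('a) = real DIM('a) * measure lborel (ball (0::'a::euclidean_space) 1)"
proof -
  have m: "real DIM('a) / 2 > 0" by simp
  have G: "Gamma (real DIM('a) / 2 + 1) = real DIM('a) / 2 * Gamma (real DIM('a) / 2)"
    by (intro Gamma_plus1) (use m nonpos_Ints_nonpos in force)
  have "measure lborel (ball (0::'a) 1) = pi powr (real DIM('a) / 2) / Gamma (real DIM('a) / 2 + 1)"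
    using content_ball[of 1 "0::'a"] by (simp add: unit_ball_vol_def)
  then show ?thesis
    unfolding omega_def G using Gamma_real_pos[OF m] by simp
qed

text \<open>After cancellation the sphere mean is the average of u, composed with radial projection,
  over the punctured unit ball, and an average lies between any two bounds of its integrand.\<close>

lemma sphere_mean_bound:
  fixes x :: "'a::euclidean_space"
  assumes "r > 0" and u: "continuous_on (sphere x r) u"
    and bound: "\<And>z. z \<in> sphere x r \<Longrightarrow> \<bar>u z - a\<bar> \<le> e"
  shows "\<bar>sphere_mean u x r - a\<bar> \<le> e"
proof -
  let ?B = "ball 0 1 - {0} :: 'a set"
  define g where "g y = u (x + r *\<^sub>R (y /\<^sub>R norm y))" for y
  define V where "V = measure lborel (ball (0::'a) 1)"
  have V: "V > 0" by (simp add: V_def content_ball_pos)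
  have VB: "measure lborel ?B = V"
    unfolding V_def by (rule measure_Diff_null_set) auto
  have gb: "\<bar>g y - a\<bar> \<le> e" if "y \<in> ?B" for y
    unfolding g_def using that \<open>r > 0\<close> by (intro bound) (auto simp: dist_norm)
  have fin: "emeasure lborel ?B < \<infinity>"
    by (rule le_less_trans[OF emeasure_mono emeasure_lborel_ball_finite[of 0 1]]) auto
  have const: "set_integrable lborel ?B (\<lambda>_. c)" for c :: real
    unfolding set_integrable_def using fin by (intro integrable_scaleR_left) auto
  have const_int: "(LINT y:?B|lborel. c) = V * c" for c :: real
    unfolding set_lebesgue_integral_def using VB fin by simp
  have "continuous_on ?B g"
    unfolding g_def
  proof (rule continuous_on_compose2[OF u])
    show "continuous_on ?B (\<lambda>y. x + r *\<^sub>R (y /\<^sub>R norm y))"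
      by (intro continuous_intros) auto
    show "(\<lambda>y. x + r *\<^sub>R (y /\<^sub>R norm y)) ` ?B \<subseteq> sphere x r"
      using \<open>r > 0\<close> by (intro image_subsetI) (simp add: dist_norm)
  qed
  then have "set_borel_measurable lborel ?B g"
    unfolding set_borel_measurable_def
    using borel_measurable_continuous_on_indicator[of ?B g] by simp
  then have g: "set_integrable lborel ?B g"
    by (rule set_integrable_bound[OF const[of "\<bar>a\<bar> + e"]]) (use gb in force)
  have "sphere_mean u x r = (LINT y:?B|lborel. g y) / V"
    unfolding sphere_mean_def omega_eq sphere_integral_eq[OF assms(1,2)] g_def V_def
    using \<open>r > 0\<close> by simp
  moreover have "(LINT y:?B|lborel. g y) \<le> V * (a + e)"
    unfolding const_int[symmetric]
    by (rule set_integral_mono[OF g const]) (use gb in force)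
  moreover have "V * (a - e) \<le> (LINT y:?B|lborel. g y)"
    unfolding const_int[symmetric]
    by (rule set_integral_mono[OF const g]) (use gb in force)
  ultimately have "sphere_mean u x r \<le> a + e" "a - e \<le> sphere_mean u x r"
    using V by (simp_all add: pos_divide_le_eq pos_le_divide_eq mult.commute)
  then show ?thesis by linarith
qed

lemma sphere_mean_tendsto:
  fixes x :: "'a::euclidean_space"
  assumes "open D" "x \<in> D" and u: "continuous_on D u"
  shows "(sphere_mean u x \<longlongrightarrow> u x) (at_right 0)"
proof (rule tendstoI)
  fix e :: real assume "e > 0"
  have "isCont u x" using assms by (simp add: continuous_on_eq_continuous_at)
  then obtain d where d: "d > 0" "\<And>z. dist z x < d \<Longrightarrow> dist (u z) (u x) < e / 2"
    using \<open>e > 0\<close> unfolding continuous_at_eps_delta by (meson half_gt_zero)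
  obtain d' where d': "d' > 0" "cball x d' \<subseteq> D"
    using assms by (meson open_contains_cball)
  have "dist (sphere_mean u x r) (u x) < e" if r: "0 < r" "r < min d d'" for r
  proof -
    have "\<bar>sphere_mean u x r - u x\<bar> \<le> e / 2"
    proof (rule sphere_mean_bound[OF r(1)])
      show "continuous_on (sphere x r) u"
        using r d' by (intro continuous_on_subset[OF u]) (auto simp: subset_iff)
      show "\<bar>u z - u x\<bar> \<le> e / 2" if "z \<in> sphere x r" for z
      proof -
        have "dist (u z) (u x) < e / 2"
          using that r by (intro d(2)) (simp add: dist_commute)
        then show ?thesis by (simp add: dist_real_def)
      qed
    qed
    then show ?thesis using \<open>e > 0\<close> by (simp add: dist_real_def)
  qed
  then show "\<forall>\<^sub>F r in at_right 0. dist (sphere_mean u x r) (u x) < e"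
    using d(1) d'(1) by (intro eventually_at_rightI[of 0 "min d d'"]) auto
qed

section \<open>Integrals over balls and annuli\<close>

lemma cball_integrable:
  fixes x :: "'a::euclidean_space" and u :: "'a \<Rightarrow> real"
  assumes "continuous_on D u" "cball x R \<subseteq> D" "S \<in> sets lborel" "S \<subseteq> cball x R"
  shows "set_integrable lborel S u"
proof (rule set_integrable_subset)
  show "set_integrable lborel (cball x R) u"
    unfolding set_integrable_def
    using assms by (intro borel_integrable_compact) (auto intro: continuous_on_subset)
qed (use assms in auto)

lemma null_sets_sphere: "sphere x r \<in> null_sets lborel"
  using negligible_sphere[of x r]
  by (auto simp: null_sets_completion_iff negligible_iff_null_sets)

lemma annulus_conv: "annulus x r1 r2 = ball x r2 - cball x r1"
  by (auto simp: annulus_def)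

lemma annulus_sets [measurable]: "annulus x r1 r2 \<in> sets borel"
  by (simp add: annulus_conv)

lemma measure_annulus:
  fixes x :: "'a::euclidean_space"
  assumes "0 < r1" "r1 < r2"
  shows "measure lborel (annulus x r1 r2) =
    unit_ball_vol (real DIM('a)) * (r2 ^ DIM('a) - r1 ^ DIM('a))"
proof -
  have "cball x r1 \<subseteq> ball x r2" using assms by auto
  then have "measure lborel (annulus x r1 r2) = measure lborel (ball x r2) - measure lborel (cball x r1)"
    unfolding annulus_conv using emeasure_lborel_ball_finite[of x r2]
    by (intro measure_Diff) (auto simp: less_top)
  also have "\<dots> = unit_ball_vol (real DIM('a)) * (r2 ^ DIM('a) - r1 ^ DIM('a))"
    using content_ball[of r2 x] content_cball[of r1 x] assms by (simp add: right_diff_distrib)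
  finally show ?thesis .
qed

text \<open>The annulus and the inner ball together miss only the sphere of radius r1 in the outer
  ball, which is a null set.\<close>

lemma integral_annulus:
  fixes x :: "'a::euclidean_space" and u :: "'a \<Rightarrow> real"
  assumes u: "continuous_on D u" "cball x r2 \<subseteq> D" and r: "0 < r1" "r1 < r2"
  shows "(LINT y:annulus x r1 r2|lborel. u y) =
    (LINT y:ball x r2|lborel. u y) - (LINT y:ball x r1|lborel. u y)"
proof -
  have int: "set_integrable lborel S u" if "S \<in> sets lborel" "S \<subseteq> cball x r2" for S
    using cball_integrable[OF u that] .
  let ?U = "annulus x r1 r2 \<union> ball x r1"
  have "AE y in lborel. y \<notin> sphere x r1"
    by (rule AE_not_in[OF null_sets_sphere])
  then have "AE y in lborel. y \<in> ?U \<longleftrightarrow> y \<in> ball x r2"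
    by eventually_elim (use r in \<open>auto simp: annulus_def\<close>)
  moreover have "?U \<subseteq> cball x r2" "ball x r2 \<subseteq> cball x r2" "ball x r1 \<subseteq> cball x r2"
      "annulus x r1 r2 \<subseteq> cball x r2"
    using r by (auto simp: annulus_def)
  moreover have "set_borel_measurable lborel S u" if "S \<in> sets lborel" "S \<subseteq> cball x r2" for S
    using int[OF that] unfolding set_integrable_def set_borel_measurable_def by auto
  ultimately have "(LINT y:ball x r2|lborel. u y) = (LINT y:?U|lborel. u y)"
    by (intro set_integral_cong_set) auto
  also have "\<dots> = (LINT y:annulus x r1 r2|lborel. u y) + (LINT y:ball x r1|lborel. u y)"
    using r by (intro set_integral_Un int) (auto simp: annulus_def)
  finally show ?thesis by simp
qed

lemma integral_ball_tendsto_0: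
  fixes x :: "'a::euclidean_space" and u :: "'a \<Rightarrow> real"
  assumes u: "continuous_on D u" "cball x R \<subseteq> D" and "R > 0"
  shows "((\<lambda>r. LINT y:ball x r|lborel. u y) \<longlongrightarrow> 0) (at_right 0)"
proof -
  have "bounded (u ` cball x R)"
    using u by (intro compact_imp_bounded compact_continuous_image) (auto intro: continuous_on_subset)
  then obtain M where M: "\<And>y. y \<in> cball x R \<Longrightarrow> \<bar>u y\<bar> \<le> M"
    unfolding bounded_iff by fastforce
  let ?c = "unit_ball_vol (real DIM('a))"
  have le: "\<bar>LINT y:ball x r|lborel. u y\<bar> \<le> M * (?c * r ^ DIM('a))" if r: "0 < r" "r < R" for r
  proof -
    have int: "set_integrable lborel (ball x r) u"
      using r by (intro cball_integrable[OF u]) auto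
    have "\<bar>LINT y:ball x r|lborel. u y\<bar> \<le> (LINT y:ball x r|lborel. \<bar>u y\<bar>)"
      using set_integral_norm_bound[OF int] by simp
    also have "\<dots> \<le> (LINT y:ball x r|lborel. M)"
    proof (rule set_integral_mono)
      show "set_integrable lborel (ball x r) (\<lambda>y. \<bar>u y\<bar>)"
        using set_integrable_norm[OF int] by simp
      show "set_integrable lborel (ball x r) (\<lambda>y. M)"
        unfolding set_integrable_def using emeasure_lborel_ball_finite[of x r]
        by (intro integrable_scaleR_left) auto
      show "\<And>y. y \<in> ball x r \<Longrightarrow> \<bar>u y\<bar> \<le> M" using r by (intro M) auto
    qed
    also have "\<dots> = M * (?c * r ^ DIM('a))"
      unfolding set_lebesgue_integral_def
      using emeasure_lborel_ball_finite[of x r] content_ball[of r x] r by simp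
    finally show ?thesis .
  qed
  show ?thesis
  proof (rule Lim_null_comparison)
    show "\<forall>\<^sub>F r in at_right 0. norm (LINT y:ball x r|lborel. u y) \<le> M * (?c * r ^ DIM('a))"
      using le \<open>R > 0\<close> by (intro eventually_at_rightI[of 0 R]) auto
    have "((\<lambda>r. M * (?c * r ^ DIM('a))) \<longlongrightarrow> M * (?c * 0 ^ DIM('a))) (at_right 0)"
      by (intro tendsto_intros)
    then show "((\<lambda>r. M * (?c * r ^ DIM('a))) \<longlongrightarrow> 0) (at_right 0)"
      by (simp add: zero_power)
  qed
qed

text \<open>The volume of the annulus cancels, leaving increments of two functions of the radius.
  The sphere radius r is any positive number here, so that one statement covers all three
  alternatives of the theorem.\<close>

lemma MV_identity_iff:
  fixes x :: "'a::euclidean_space" and u :: "'a \<Rightarrow> real"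
  assumes "DIM('a) \<ge> 2" "\<mu> > 0"
    and u: "continuous_on D u" "cball x r2 \<subseteq> D" and r: "0 < r1" "r1 < r2" "r > 0"
  defines "F \<equiv> \<lambda>r. LINT y:ball x r|lborel. u y"
    and "G \<equiv> \<lambda>r. hyp01 (real DIM('a) / 2 + 1) ((\<mu> * r / 2)\<^sup>2) *
      (unit_ball_vol (real DIM('a)) * r ^ DIM('a))"
    and "A \<equiv> \<lambda>r. hyp01 (real DIM('a) / 2) ((\<mu> * r / 2)\<^sup>2)"
  shows "MV_identity \<mu> u x r1 r2 r \<longleftrightarrow>
    F r2 - F r1 = (G r2 - G r1) * (sphere_mean u x r / A r)"
proof -
  have pos: "measure lborel (annulus x r1 r2) > 0"
    unfolding measure_annulus[OF r(1,2)] using r by (simp add: power_strict_mono)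
  have A: "a_circ DIM('a) (\<mu> * r) = A r"
    using assms by (simp add: A_def a_circ_hyp01)
  have G: "a_bullet DIM('a) (\<mu> * s) * measure lborel (ball x s) = G s" if "s > 0" for s
    using that assms content_ball[of s x] by (simp add: G_def a_bullet_hyp01)
  have "P / (A r * measure lborel (annulus x r1 r2)) * (1 / (omega DIM('a) * r ^ (DIM('a) - 1))) *
      sphere_integral u x r = P * (sphere_mean u x r / A r) / measure lborel (annulus x r1 r2)" for P
    by (simp add: sphere_mean_def)
  then show ?thesis
    unfolding MV_identity_def integral_annulus[OF u r(1,2)] A F_def
    using G[of r1] G[of r2] r pos by (simp only: divide_cancel_right) auto
qed

text \<open>F and G vanish at 0+, while the normalised sphere mean N tends to \<open>u x\<close>.
  The alternatives differ in how the sphere radius behaves as the inner radius shrinks, hence in the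
  order in which these limits can be taken.\<close>

lemma ball_mean_value:
  fixes D :: "'a::euclidean_space set" and u :: "'a \<Rightarrow> real" and \<mu> R :: real
  assumes m: "DIM('a) \<ge> 2" and D: "open D" and \<mu>: "\<mu> > 0" and u: "continuous_on D u"
    and hyp: "(\<forall>x\<in>D. \<forall>r1 r2. 0 < r1 \<and> r1 < r2 \<and> cball x r2 \<subseteq> D \<longrightarrow>
              (\<forall>r\<in>{r1<..<r2}. MV_identity \<mu> u x r1 r2 r))
       \<or> (\<forall>x\<in>D. \<forall>r1 r2. 0 < r1 \<and> r1 < r2 \<and> cball x r2 \<subseteq> D \<longrightarrow> MV_identity \<mu> u x r1 r2 r1)
       \<or> (\<forall>x\<in>D. \<forall>r1 r2. 0 < r1 \<and> r1 < r2 \<and> cball x r2 \<subseteq> D \<longrightarrow> MV_identity \<mu> u x r1 r2 r2)"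
    and x: "x \<in> D" and R: "R > 0" "cball x R \<subseteq> D"
  shows "(LINT y:ball x R|lborel. u y) =
    hyp01 (real DIM('a) / 2 + 1) ((\<mu> * R / 2)\<^sup>2) * (unit_ball_vol (real DIM('a)) * R ^ DIM('a)) * u x"
proof -
  define F where "F r = (LINT y:ball x r|lborel. u y)" for r
  define G where "G r = hyp01 (real DIM('a) / 2 + 1) ((\<mu> * r / 2)\<^sup>2) *
      (unit_ball_vol (real DIM('a)) * r ^ DIM('a))" for r
  define A where "A r = hyp01 (real DIM('a) / 2) ((\<mu> * r / 2)\<^sup>2)" for r
  define N where "N r = sphere_mean u x r / A r" for r
  have A0: "(A \<longlongrightarrow> 1) (at_right 0)"
  proof -
    have "continuous_on UNIV A"
      unfolding A_def using m by (intro continuous_intros) auto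
    then have "(A \<longlongrightarrow> A 0) (at_right 0)"
      by (metis UNIV_I continuous_on_def tendsto_within_subset top_greatest)
    then show ?thesis by (simp add: A_def)
  qed
  have G0: "(G \<longlongrightarrow> 0) (at_right 0)"
  proof -
    have "continuous_on UNIV G"
      unfolding G_def using m by (intro continuous_intros) auto
    then have "(G \<longlongrightarrow> G 0) (at_right 0)"
      by (metis UNIV_I continuous_on_def tendsto_within_subset top_greatest)
    then show ?thesis using m by (simp add: G_def zero_power)
  qed
  have F0: "(F \<longlongrightarrow> 0) (at_right 0)"
    using integral_ball_tendsto_0[OF u R(2,1)] by (simp add: F_def[abs_def])
  have N0: "(N \<longlongrightarrow> u x) (at_right 0)"
    using tendsto_divide[OF sphere_mean_tendsto[OF D x u] A0] by (simp add: N_def[abs_def])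
  have A_pos: "A r > 0" for r
    unfolding A_def using m by (intro hyp01_pos) auto
  have G_pos: "G r > 0" if "r > 0" for r
    unfolding G_def using that m by (intro mult_pos_pos hyp01_pos) auto
  have F_diff: "((\<lambda>r. F s - F r) \<longlongrightarrow> F s) (at_right 0)" for s
    using tendsto_diff[OF tendsto_const F0, of "F s"] by simp
  have G_diff: "((\<lambda>r. G s - G r) \<longlongrightarrow> G s) (at_right 0)" for s
    using tendsto_diff[OF tendsto_const G0, of "G s"] by simp
  have ev: "\<forall>\<^sub>F r in at_right 0. P r" if "s > 0" "\<And>r. 0 < r \<Longrightarrow> r < s \<Longrightarrow> P r" for P and s :: real
    using that by (intro eventually_at_rightI[of 0 s]) auto
  have mv: "MV_identity \<mu> u x r1 r2 r \<longleftrightarrow> F r2 - F r1 = (G r2 - G r1) * N r"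
    if "0 < r1" "r1 < r2" "r2 \<le> R" "r > 0" for r1 r2 r
    unfolding F_def G_def N_def A_def using that R
    by (intro MV_identity_iff[OF m \<mu> u]) (auto intro: subset_trans[OF subset_cball])
  have adm: "cball x r \<subseteq> D" if "r \<le> R" for r
    using that R by (auto intro: subset_trans[OF subset_cball])
  have "F R = G R * u x"
    using hyp
  proof (elim disjE)
    assume 1: "\<forall>x\<in>D. \<forall>r1 r2. 0 < r1 \<and> r1 < r2 \<and> cball x r2 \<subseteq> D \<longrightarrow>
              (\<forall>r\<in>{r1<..<r2}. MV_identity \<mu> u x r1 r2 r)"
    \<comment> \<open>Two successive limits: the inner radius s tends to 0 with r fixed, and only
      afterwards r tends to 0.\<close>
    have "F R = G R * N r" if r: "0 < r" "r < R" for r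
    proof (rule tendsto_unique[OF _ F_diff])
      have "((\<lambda>s. (G R - G s) * N r) \<longlongrightarrow> G R * N r) (at_right 0)"
        by (intro tendsto_intros G_diff)
      then show "((\<lambda>s. F R - F s) \<longlongrightarrow> G R * N r) (at_right 0)"
      proof (rule Lim_transform_eventually, intro ev[OF r(1)])
        fix s assume s: "0 < s" "s < r"
        then have "MV_identity \<mu> u x s R r" using 1 x R r by auto
        then show "(G R - G s) * N r = F R - F s" using mv[of s R r] s r by simp
      qed
    qed simp
    then have *: "\<forall>\<^sub>F r in at_right 0. G R * N r = F R"
      by (intro ev[OF R(1)]) auto
    show ?thesis
      by (rule tendsto_unique[OF _ Lim_transform_eventually[OF _ *] , THEN sym])
        (use tendsto_mult_left[OF N0] in auto)
  next
    assume 2: "\<forall>x\<in>D. \<forall>r1 r2. 0 < r1 \<and> r1 < r2 \<and> cball x r2 \<subseteq> D \<longrightarrow> MV_identity \<mu> u x r1 r2 r1"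
    \<comment> \<open>The sphere shrinks together with the inner ball, so a single limit
      suffices.\<close>
    show ?thesis
    proof (rule tendsto_unique[OF _ F_diff])
      have "((\<lambda>s. (G R - G s) * N s) \<longlongrightarrow> G R * u x) (at_right 0)"
        by (intro tendsto_intros G_diff N0)
      then show "((\<lambda>s. F R - F s) \<longlongrightarrow> G R * u x) (at_right 0)"
      proof (rule Lim_transform_eventually, intro ev[OF R(1)])
        fix s assume s: "0 < s" "s < R"
        then have "MV_identity \<mu> u x s R s" using 2 x R by auto
        then show "(G R - G s) * N s = F R - F s" using mv[of s R s] s by simp
      qed
    qed simp
  next
    \<comment> \<open>Here \<open>N\<close> is constant on \<open>(0, R]\<close>: compare the identity on the annulus with its limit
      \<open>F r = G r * N r\<close>. Polar coordinates are thereby avoided.\<close>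
    assume 3: "\<forall>x\<in>D. \<forall>r1 r2. 0 < r1 \<and> r1 < r2 \<and> cball x r2 \<subseteq> D \<longrightarrow> MV_identity \<mu> u x r1 r2 r2"
    have eq: "F r - F s = (G r - G s) * N r" if "0 < s" "s < r" "r \<le> R" for r s
      using 3 x adm[of r] mv[of s r r] that by auto
    have FG: "F r = G r * N r" if r: "0 < r" "r \<le> R" for r
    proof (rule tendsto_unique[OF _ F_diff])
      have "((\<lambda>s. (G r - G s) * N r) \<longlongrightarrow> G r * N r) (at_right 0)"
        by (intro tendsto_intros G_diff)
      then show "((\<lambda>s. F r - F s) \<longlongrightarrow> G r * N r) (at_right 0)"
        by (rule Lim_transform_eventually, intro ev[OF r(1)]) (use eq r in auto)
    qed simp
    have "N s = N R" if s: "0 < s" "s < R" for s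
      using eq[OF s] FG[of s] FG[of R] s R G_pos[OF s(1)] by (simp add: algebra_simps)
    then have "\<forall>\<^sub>F s in at_right 0. N s = N R"
      by (intro ev[OF R(1)]) auto
    then have "(N \<longlongrightarrow> N R) (at_right 0)"
      by (rule tendsto_eventually)
    then have "N R = u x"
      using N0 by (intro tendsto_unique[of "at_right 0" N]) auto
    then show ?thesis using FG[of R] R by simp
  qed
  then show ?thesis by (simp add: F_def G_def)
qed

section \<open>Radial kernels\<close>

text \<open>A layer-cake formula: since \<Phi> vanishes at R, its value at \<open>dist x y\<close>
  is the integral of w from \<open>dist x y\<close> to R. The kernel is thus a superposition of
  indicators of balls with weight w, and Fubini's theorem exchanges the two integrations.\<close>

lemma integral_layers:
  fixes f :: "'a::euclidean_space \<Rightarrow> real"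
  assumes f: "integrable lborel f"
    and w: "continuous_on UNIV w"
    and \<Phi>: "\<And>s. 0 \<le> s \<Longrightarrow> s \<le> R \<Longrightarrow> (\<Phi> has_real_derivative - w s) (at s)"
    and "\<Phi> R = 0"
  shows "(LINT y:ball x R|lborel. \<Phi> (dist x y) * f y) =
    (LINT s:{0..R}|lborel. w s * (LINT y:ball x s|lborel. f y))"
proof -
  have [measurable]: "f \<in> borel_measurable borel"
    using f by auto
  have [measurable]: "w \<in> borel_measurable borel"
    using w by (rule borel_measurable_continuous_onI)
  define h where "h s = indicator {0..R} s * w s" for s :: real
  define K where "K s y = h s * (indicator {p. dist x (snd p) < fst p} (s, y) * f y)" for s y
  have h: "integrable lborel h"
    using borel_integrable_compact[of "{0..R}" w] continuous_on_subset[OF w, of "{0..R}"]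
    by (simp add: h_def[abs_def])
  have [measurable]: "h \<in> borel_measurable borel"
    using h by auto
  have "integrable (lborel \<Otimes>\<^sub>M lborel) (\<lambda>p. h (fst p) * f (snd p))"
    by (rule lborel_pair.Fubini_integrable) (use h f in \<open>auto simp: abs_mult\<close>)
  moreover have "{p \<in> space (borel \<Otimes>\<^sub>M borel). dist x (snd p) < fst p} \<in> sets (borel \<Otimes>\<^sub>M (borel :: 'a measure))"
    by measurable
  then have [measurable]: "{p. dist x (snd p) < fst p} \<in> sets (borel \<Otimes>\<^sub>M (borel :: 'a measure))"
    by (simp add: space_pair_measure)
  have "case_prod K \<in> borel_measurable (lborel \<Otimes>\<^sub>M lborel)"
    unfolding K_def by measurable
  ultimately have "integrable (lborel \<Otimes>\<^sub>M lborel) (case_prod K)"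
    by (rule Bochner_Integration.integrable_bound) (auto simp: K_def indicator_def abs_mult)
  then have Fubini: "(LINT y|lborel. (LINT s|lborel. K s y)) = (LINT s|lborel. (LINT y|lborel. K s y))"
    by (rule lborel_pair.Fubini_integral)
  have "(LINT s|lborel. K s y) = indicator (ball x R) y * (\<Phi> (dist x y) * f y)" for y
  proof (cases "dist x y < R")
    case True
    have "(LINT s|lborel. K s y) = (LINT s|lborel. f y * (indicator {dist x y..R} s *\<^sub>R w s))"
    proof (rule integral_cong_AE)
      \<comment> \<open>Balls are open, whereas the interval needed for the fundamental theorem is
        closed: the integrands may differ at the point \<open>s = dist x y\<close>.\<close>
      show "AE s in lborel. K s y = f y * (indicator {dist x y..R} s *\<^sub>R w s)"
        using AE_lborel_singleton[of "dist x y"]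
        by eventually_elim
          (auto simp: K_def h_def indicator_def intro: order_trans[OF zero_le_dist])
    qed (auto simp: K_def indicator_def)
    also have "\<dots> = f y * (LINT s|lborel. indicator {dist x y..R} s *\<^sub>R w s)"
      by simp
    also have "(LINT s|lborel. indicator {dist x y..R} s *\<^sub>R w s) = (- \<Phi> R) - (- \<Phi> (dist x y))"
    proof (rule integral_FTC_atLeastAtMost)
      fix s assume s: "dist x y \<le> s" "s \<le> R"
      then have "(\<Phi> has_real_derivative - w s) (at s)"
        using zero_le_dist[of x y] by (intro \<Phi>) linarith+
      then show "((\<lambda>s. - \<Phi> s) has_vector_derivative w s) (at s within {dist x y..R})"
        unfolding has_real_derivative_iff_has_vector_derivative[symmetric]
        by (auto intro!: derivative_eq_intros elim: DERIV_subset)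
    qed (use True continuous_on_subset[OF w] in auto)
    finally show ?thesis
      using True \<open>\<Phi> R = 0\<close> by simp
  next
    case False
    then have "K s y = 0" for s by (auto simp: K_def h_def indicator_def)
    then show ?thesis using False by simp
  qed
  moreover have "(LINT y|lborel. K s y) =
      indicator {0..R} s * (w s * (LINT y:ball x s|lborel. f y))" for s
    by (simp add: K_def h_def set_lebesgue_integral_def indicator_def)
  ultimately show ?thesis
    using Fubini by (simp add: set_lebesgue_integral_def)
qed

text \<open>The integrands differ by the derivative of a function vanishing at both ends. Behind this is
  Bessel's equation for \<open>hyp01\<close>, here encoded in the contiguity relation.\<close>

lemma radial_integrals:
  fixes \<mu> R c :: real and m :: nat
  assumes "R \<ge> 0"
  defines "G \<equiv> \<lambda>s. hyp01 (real m / 2 + 1) ((\<mu> * s / 2)\<^sup>2) * (c * s ^ m)"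
  shows "(LINT s:{0..R}|lborel. (48 * R\<^sup>2 * s - 4 * (6 * real m + 24) * s * (R\<^sup>2 - s\<^sup>2)) * G s) =
    \<mu>\<^sup>2 * (LINT s:{0..R}|lborel. 6 * s * (R\<^sup>2 - s\<^sup>2)\<^sup>2 * G s)"
proof -
  define q where "q = real m / 2 + 1"
  have q: "q \<ge> 1" by (simp add: q_def)
  define z where "z s = (\<mu> * s / 2)\<^sup>2" for s
  define w1 where "w1 s = (48 * R\<^sup>2 * s - 4 * (6 * real m + 24) * s * (R\<^sup>2 - s\<^sup>2)) * G s" for s
  define w2 where "w2 s = 6 * s * (R\<^sup>2 - s\<^sup>2)\<^sup>2 * G s" for s
  \<comment> \<open>With this K the derivative of z is \<open>q * K * s\<close>, whose q cancels the
    denominator in \<open>DERIV_hyp01\<close>. Eliminating \<mu> and m in favour of q and K turns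
    the final check into polynomial algebra.\<close>
  define K where "K = \<mu>\<^sup>2 / (2 * q)"
  have \<mu>: "\<mu>\<^sup>2 = 2 * q * K" using q by (simp add: K_def)
  \<comment> \<open>For m \<ge> 2 this is the boundary term of Green's identity. With k(s) = (R^2 -
    s^2)^3 and U(s) = \<open>hyp01 (q - 1) (z s)\<close>, it equals (Laplacian of k) G - m c s^(m-1)
    k' U; contiguity at q - 1 eliminates U, and the multiples of s^m alone cancel. The power of s
    makes it vanish at 0, the factor R^2 - s^2 at R.\<close>
  define H where "H s = 6 * c * s ^ (m + 2) * ((R\<^sup>2 - s\<^sup>2)\<^sup>2 * K * hyp01 (q + 1) (z s)
      + 4 * (R\<^sup>2 - s\<^sup>2) * hyp01 q (z s))" for s
  have G: "continuous_on UNIV G"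
    unfolding G_def by (intro continuous_intros) auto
  then have cont: "continuous_on {0..R} w1" "continuous_on {0..R} w2"
    unfolding w1_def w2_def
    by (auto intro!: continuous_intros intro: continuous_on_subset)
  have int: "set_integrable lborel {0..R} w1" "set_integrable lborel {0..R} (\<lambda>s. \<mu>\<^sup>2 * w2 s)"
    using cont by (auto intro!: borel_integrable_atLeastAtMost' continuous_intros)
  have dz: "(z has_real_derivative q * K * s) (at s)" for s
    unfolding z_def using \<mu> by (auto intro!: derivative_eq_intros simp: power2_eq_square)
  have dH: "(H has_real_derivative \<mu>\<^sup>2 * w2 s - w1 s) (at s)" for s
  proof -
    define h0 h1 h2 where "h0 = hyp01 q (z s)" and "h1 = hyp01 (q + 1) (z s)"
      and "h2 = hyp01 (q + 2) (z s) / (q + 1)"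
    have d0: "((\<lambda>s. hyp01 q (z s)) has_real_derivative h1 * K * s) (at s)"
      using DERIV_chain2[OF DERIV_hyp01[OF q] dz] q by (simp add: h1_def mult.assoc)
    have d1: "((\<lambda>s. hyp01 (q + 1) (z s)) has_real_derivative h2 * q * K * s) (at s)"
      using DERIV_chain2[OF DERIV_hyp01[of "q + 1"] dz] q by (simp add: h2_def add.assoc mult.assoc)
    have h0: "h0 = h1 + K * s\<^sup>2 / 2 * h2"
    proof -
      have zs: "z s = q * (K * s\<^sup>2 / 2)"
        by (simp add: z_def power_mult_distrib power_divide \<mu>)
      have "z s / (q * (q + 1)) = K * s\<^sup>2 / 2 / (q + 1)"
        unfolding zs using q by simp
      then show ?thesis
        using hyp01_contiguous[OF q, of "z s"] by (simp add: h0_def h1_def h2_def)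
    qed
    have m: "real m = 2 * q - 2" by (simp add: q_def)
    have w1: "w1 s = (48 * R\<^sup>2 * s - 4 * (12 * q + 12) * s * (R\<^sup>2 - s\<^sup>2)) * (h0 * (c * s ^ m))"
      by (simp add: w1_def G_def h0_def z_def m) (simp add: q_def)
    have w2: "w2 s = 6 * s * (R\<^sup>2 - s\<^sup>2)\<^sup>2 * (h0 * (c * s ^ m))"
      by (simp add: w2_def G_def h0_def z_def q_def)
    have p: "((\<lambda>s. s ^ (m + 2)) has_real_derivative 2 * q * (s * s ^ m)) (at s)"
      by (rule DERIV_cong[OF DERIV_pow]) (simp add: q_def)
    \<comment> \<open>The product rule for arbitrary factors fixes the shape of the derivative
      before the Bessel terms are inserted.\<close>
    have gen: "((\<lambda>s. 6 * c * P s * ((R\<^sup>2 - s\<^sup>2)\<^sup>2 * K * A1 s + 4 * (R\<^sup>2 - s\<^sup>2) * A0 s))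
        has_real_derivative
        6 * c * P' * ((R\<^sup>2 - s\<^sup>2)\<^sup>2 * K * A1 s + 4 * (R\<^sup>2 - s\<^sup>2) * A0 s) +
        6 * c * P s * (2 * (R\<^sup>2 - s\<^sup>2) * (- 2 * s) * K * A1 s + (R\<^sup>2 - s\<^sup>2)\<^sup>2 * K * A1'
          + 4 * (- 2 * s) * A0 s + 4 * (R\<^sup>2 - s\<^sup>2) * A0')) (at s)"
      if "(P has_real_derivative P') (at s)" "(A0 has_real_derivative A0') (at s)"
        "(A1 has_real_derivative A1') (at s)" for P A0 A1 P' A0' A1'
      using that by (auto intro!: derivative_eq_intros simp: algebra_simps)
    have "(H has_real_derivative
        6 * c * (2 * q * (s * s ^ m)) * ((R\<^sup>2 - s\<^sup>2)\<^sup>2 * K * h1 + 4 * (R\<^sup>2 - s\<^sup>2) * h0) +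
        6 * c * s ^ (m + 2) * (2 * (R\<^sup>2 - s\<^sup>2) * (- 2 * s) * K * h1 + (R\<^sup>2 - s\<^sup>2)\<^sup>2 * K * (h2 * q * K * s)
          + 4 * (- 2 * s) * h0 + 4 * (R\<^sup>2 - s\<^sup>2) * (h1 * K * s))) (at s)"
      unfolding H_def h0_def h1_def by (rule gen[OF p d0 d1, unfolded h1_def])
    \<comment> \<open>Once contiguity has expressed h0 by h1 and h2, the equation is an identity of
      polynomials with h1, h2 and \<open>s ^ m\<close> as independent symbols.\<close>
    then show ?thesis
      by (rule DERIV_cong) (simp only: w1 w2 \<mu> h0, simp add: algebra_simps power2_eq_square)
  qed
  have "(LINT s:{0..R}|lborel. \<mu>\<^sup>2 * w2 s - w1 s) = H R - H 0"
    unfolding set_lebesgue_integral_def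
  proof (rule integral_FTC_atLeastAtMost[OF \<open>R \<ge> 0\<close>])
    show "(H has_vector_derivative \<mu>\<^sup>2 * w2 s - w1 s) (at s within {0..R})" for s
      unfolding has_real_derivative_iff_has_vector_derivative[symmetric]
      by (rule DERIV_subset[OF dH]) auto
  qed (use cont in \<open>auto intro!: continuous_intros\<close>)
  also have "\<dots> = 0" by (simp add: H_def)
  finally have "(LINT s:{0..R}|lborel. \<mu>\<^sup>2 * w2 s) = (LINT s:{0..R}|lborel. w1 s)"
    using set_integral_diff(2)[OF int(2,1)] by simp
  then show ?thesis by (simp add: w1_def w2_def)
qed

section \<open>Convolution with a twice differentiable kernel\<close>

lemma partial_cong:
  assumes "open S" "x \<in> S" "\<And>y. y \<in> S \<Longrightarrow> f y = g y"
  shows "partial i f x = partial i g x"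
    and "(\<lambda>t. f (x + t *\<^sub>R i)) field_differentiable (at 0) \<longleftrightarrow>
      (\<lambda>t. g (x + t *\<^sub>R i)) field_differentiable (at 0)"
proof -
  have "open ((\<lambda>t. x + t *\<^sub>R i) -` S)"
    by (intro open_vimage \<open>open S\<close> continuous_intros)
  then have ev: "\<forall>\<^sub>F t in nhds 0. f (x + t *\<^sub>R i) = g (x + t *\<^sub>R i)"
    using assms by (intro eventually_nhds[THEN iffD2] exI[of _ "(\<lambda>t. x + t *\<^sub>R i) -` S"]) auto
  show "partial i f x = partial i g x"
    unfolding partial_def by (rule deriv_cong_ev[OF ev refl])
  show "(\<lambda>t. f (x + t *\<^sub>R i)) field_differentiable (at 0) \<longleftrightarrow>
      (\<lambda>t. g (x + t *\<^sub>R i)) field_differentiable (at 0)"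
    unfolding field_differentiable_def using DERIV_cong_ev[OF refl ev refl] by metis
qed

lemma has_partial_on_cong:
  assumes "open S" "\<And>y. y \<in> S \<Longrightarrow> f y = g y"
  shows "has_partial_on i f S \<longleftrightarrow> has_partial_on i g S"
  unfolding has_partial_on_def
  using partial_cong(2)[OF assms(1), where f = f and g = g] assms(2) by blast

lemma C2_on_cong:
  assumes S: "open S" and eq: "\<And>y. y \<in> S \<Longrightarrow> f y = g y"
  shows "C2_on S f \<longleftrightarrow> C2_on S g"
proof -
  have 1: "partial i f y = partial i g y" if "y \<in> S" for i y
    by (rule partial_cong(1)[OF S that eq])
  have 2: "partial j (partial i f) y = partial j (partial i g) y" if "y \<in> S" for i j y
    by (rule partial_cong(1)[OF S that 1])
  have "has_partial_on i f S = has_partial_on i g S" for i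
    using S eq by (rule has_partial_on_cong)
  moreover have "has_partial_on j (partial i f) S = has_partial_on j (partial i g) S" for i j
    using S 1 by (rule has_partial_on_cong)
  moreover have "continuous_on S f = continuous_on S g"
    using eq by (intro continuous_on_cong) auto
  moreover have "continuous_on S (partial i f) = continuous_on S (partial i g)" for i
    using 1 by (intro continuous_on_cong) auto
  moreover have "continuous_on S (partial j (partial i f)) = continuous_on S (partial j (partial i g))" for i j
    using 2 by (intro continuous_on_cong) auto
  ultimately show ?thesis
    unfolding C2_on_def by simp
qed

lemma laplacian_cong:
  assumes S: "open S" "x \<in> S" and eq: "\<And>y. y \<in> S \<Longrightarrow> f y = g y"
  shows "laplacian f x = laplacian g x"
  unfolding laplacian_def
  by (intro sum.cong refl partial_cong(1)[OF S] partial_cong(1)[OF S(1) _ eq])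

text \<open>Transfers the result from the convolution, which is of class C^2 on the whole space, to
  u, which is shown to agree with it on a ball.\<close>

lemma panharmonic_cong:
  assumes S: "open S" and eq: "\<And>y. y \<in> S \<Longrightarrow> f y = g y"
  shows "panharmonic \<mu> S f \<longleftrightarrow> panharmonic \<mu> S g"
proof -
  have "C2_on S f = C2_on S g" using S eq by (rule C2_on_cong)
  moreover have "laplacian f x = laplacian g x" if "x \<in> S" for x
    using S that eq by (rule laplacian_cong)
  ultimately show ?thesis
    unfolding panharmonic_def using eq by simp
qed

text \<open>Every condition concerns a single point or continuity at a point. As
  \<open>partial\<close> does not refer to a domain, the derivatives obtained on different
  neighbourhoods are the same functions and no gluing is required.\<close>

lemma panharmonic_local:
  assumes "\<And>x. x \<in> D \<Longrightarrow> \<exists>S. open S \<and> x \<in> S \<and> panharmonic \<mu> S u"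
  shows "panharmonic \<mu> D u"
proof -
  have cont: "continuous_on D h" if "\<And>S. panharmonic \<mu> S u \<Longrightarrow> continuous_on S h" for h
  proof (rule continuous_at_imp_continuous_on, rule ballI)
    fix x assume "x \<in> D"
    then show "isCont h x"
      using assms that by (metis continuous_on_eq_continuous_at)
  qed
  have "C2_on D u"
    unfolding C2_on_def
  proof (intro conjI ballI cont)
    show "has_partial_on i u D" if "i \<in> Basis" for i
      using assms that unfolding panharmonic_def C2_on_def has_partial_on_def by metis
    show "has_partial_on j (partial i u) D" if "i \<in> Basis" "j \<in> Basis" for i j
      using assms that unfolding panharmonic_def C2_on_def has_partial_on_def by metis
  qed (auto simp: panharmonic_def C2_on_def)
  then show ?thesis
    using assms unfolding panharmonic_def by metis
qed

lemma partial_eqI: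
  assumes "((\<lambda>t. f (x + t *\<^sub>R i)) has_real_derivative d) (at 0)"
  shows "partial i f x = d"
  unfolding partial_def by (rule DERIV_imp_deriv[OF assms])

section \<open>Differentiation under the convolution integral\<close>

lemma continuous_compact_support_bounded:
  fixes k :: "'a::euclidean_space \<Rightarrow> real"
  assumes "continuous_on UNIV k" "\<And>z. norm z > R \<Longrightarrow> k z = 0"
  obtains B where "\<And>z. \<bar>k z\<bar> \<le> B"
proof -
  have "bounded (k ` cball 0 R)"
    using assms by (intro compact_imp_bounded compact_continuous_image) (auto intro: continuous_on_subset)
  then obtain B where B: "\<And>z. norm z \<le> R \<Longrightarrow> \<bar>k z\<bar> \<le> B"
    unfolding bounded_iff by fastforce
  have "\<bar>k z\<bar> \<le> max B 0" for z
    using B[of z] assms(2)[of z] by (cases "norm z \<le> R") auto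
  then show ?thesis by (rule that)
qed

lemma conv_integrable:
  fixes k f :: "'a::euclidean_space \<Rightarrow> real"
  assumes k: "continuous_on UNIV k" "\<And>z. \<bar>k z\<bar> \<le> B" and f: "integrable lborel f"
  shows "integrable lborel (\<lambda>y. k (x - y) * f y)"
proof (rule Bochner_Integration.integrable_bound)
  show "integrable lborel (\<lambda>y. B * f y)" using f by simp
  have "continuous_on UNIV (\<lambda>y. k (x - y))"
    by (rule continuous_on_compose2[OF k(1)]) (auto intro!: continuous_intros)
  then have [measurable]: "(\<lambda>y. k (x - y)) \<in> borel_measurable borel"
    by (rule borel_measurable_continuous_onI)
  have [measurable]: "f \<in> borel_measurable borel" using f by auto
  show "(\<lambda>y. k (x - y) * f y) \<in> borel_measurable lborel" by simp
  have "\<bar>k z\<bar> \<le> \<bar>B\<bar>" for z using k(2)[of z] by simp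
  then show "AE y in lborel. norm (k (x - y) * f y) \<le> norm (B * f y)"
    by (auto simp: abs_mult intro!: mult_right_mono)
qed

text \<open>Dominated convergence with the translation placed on the kernel, so that f needs
  integrability and no regularity.\<close>

lemma conv_continuous:
  fixes k f :: "'a::euclidean_space \<Rightarrow> real"
  assumes k: "continuous_on UNIV k" "\<And>z. \<bar>k z\<bar> \<le> B" and f: "integrable lborel f"
  shows "continuous_on UNIV (\<lambda>x. LINT y|lborel. k (x - y) * f y)"
proof (rule continuous_at_imp_continuous_on, rule ballI)
  fix x :: 'a
  show "isCont (\<lambda>x. LINT y|lborel. k (x - y) * f y) x"
    unfolding continuous_at_sequentially
  proof (intro allI impI, unfold comp_def)
    fix X assume X: "X \<longlonglongrightarrow> x"
    show "(\<lambda>n. LINT y|lborel. k (X n - y) * f y) \<longlonglongrightarrow> (LINT y|lborel. k (x - y) * f y)"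
    proof (rule integral_dominated_convergence[where w = "\<lambda>y. B * \<bar>f y\<bar>"])
      show "AE y in lborel. (\<lambda>n. k (X n - y) * f y) \<longlonglongrightarrow> k (x - y) * f y"
        using k(1) X by (intro AE_I2 tendsto_intros isCont_tendsto_compose[of _ k])
          (auto simp: continuous_on_eq_continuous_at)
      show "AE y in lborel. norm (k (X n - y) * f y) \<le> B * \<bar>f y\<bar>" for n
        using k(2) by (auto simp: abs_mult intro!: mult_right_mono)
      show "(\<lambda>y. k (x - y) * f y) \<in> borel_measurable lborel"
        and "(\<lambda>y. k (X n - y) * f y) \<in> borel_measurable lborel" for n
        using conv_integrable[OF k f] by (rule borel_measurable_integrable)+
    qed (use f in auto)
  qed
qed

text \<open>The bound on k' makes k Lipschitz along the direction i, so the difference quotients are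
  bounded by B' uniformly in y, and dominated convergence applies with majorant
  \<open>B' * \<bar>f y\<bar>\<close>.\<close>

lemma conv_DERIV:
  fixes k k' f :: "'a::euclidean_space \<Rightarrow> real"
  assumes k: "continuous_on UNIV k" "\<And>z. \<bar>k z\<bar> \<le> B"
    and k': "continuous_on UNIV k'" "\<And>z. \<bar>k' z\<bar> \<le> B'"
    and deriv: "\<And>z. ((\<lambda>t. k (z + t *\<^sub>R i)) has_real_derivative k' z) (at 0)"
    and f: "integrable lborel f"
  shows "((\<lambda>t. LINT y|lborel. k (x + t *\<^sub>R i - y) * f y) has_real_derivative
    (LINT y|lborel. k' (x - y) * f y)) (at 0)"
proof -
  \<comment> \<open>The derivative at parameter 0 is known for every base point; moving the base
    point along the line gives it at every t.\<close>
  have deriv': "((\<lambda>t. k (z + t *\<^sub>R i)) has_real_derivative k' (z + t *\<^sub>R i)) (at t)" for z t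
    using DERIV_shift[of "\<lambda>t. k (z + t *\<^sub>R i)" _ 0 t] deriv[of "z + t *\<^sub>R i"]
    by (simp add: algebra_simps)
  have Lip: "\<bar>k (z + t *\<^sub>R i) - k z\<bar> \<le> B' * \<bar>t\<bar>" for z t
    using field_differentiable_bound[of UNIV "\<lambda>t. k (z + t *\<^sub>R i)" "\<lambda>t. k' (z + t *\<^sub>R i)" B' t 0]
      deriv' k'(2) by simp
  note int = conv_integrable[OF k f]
  have quot: "((LINT y|lborel. k (x + h *\<^sub>R i - y) * f y) - (LINT y|lborel. k (x - y) * f y)) / h =
      (LINT y|lborel. (k (x - y + h *\<^sub>R i) - k (x - y)) / h * f y)" for h
  proof -
    have "(LINT y|lborel. (k (x - y + h *\<^sub>R i) - k (x - y)) / h * f y) =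
        (LINT y|lborel. (k (x + h *\<^sub>R i - y) * f y - k (x - y) * f y) / h)"
      by (intro Bochner_Integration.integral_cong) (auto simp: algebra_simps diff_divide_distrib)
    also have "\<dots> = ((LINT y|lborel. k (x + h *\<^sub>R i - y) * f y) - (LINT y|lborel. k (x - y) * f y)) / h"
      using int by simp
    finally show ?thesis ..
  qed
  have "(\<lambda>h. LINT y|lborel. (k (x - y + h *\<^sub>R i) - k (x - y)) / h * f y)
      \<midarrow>0\<rightarrow> (LINT y|lborel. k' (x - y) * f y)"
    unfolding tendsto_at_iff_sequentially
  proof (intro allI impI, unfold comp_def)
    fix X :: "nat \<Rightarrow> real"
    assume X: "\<forall>n. X n \<in> UNIV - {0}" "X \<longlonglongrightarrow> 0"
    show "(\<lambda>n. LINT y|lborel. (k (x - y + X n *\<^sub>R i) - k (x - y)) / X n * f y)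
        \<longlonglongrightarrow> (LINT y|lborel. k' (x - y) * f y)"
    proof (rule integral_dominated_convergence[where w = "\<lambda>y. B' * \<bar>f y\<bar>"])
      show "(\<lambda>y. k' (x - y) * f y) \<in> borel_measurable lborel"
        using conv_integrable[OF k' f] by (rule borel_measurable_integrable)
      show "(\<lambda>y. (k (x - y + X n *\<^sub>R i) - k (x - y)) / X n * f y) \<in> borel_measurable lborel" for n
      proof -
        have "(\<lambda>y. (k (x + X n *\<^sub>R i - y) * f y - k (x - y) * f y) / X n) \<in> borel_measurable lborel"
          using int by (intro borel_measurable_integrable) auto
        then show ?thesis by (simp add: algebra_simps diff_divide_distrib)
      qed
      show "AE y in lborel. (\<lambda>n. (k (x - y + X n *\<^sub>R i) - k (x - y)) / X n * f y)
          \<longlonglongrightarrow> k' (x - y) * f y"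
      proof (intro AE_I2 tendsto_intros)
        fix y
        have "(\<lambda>h. (k (x - y + h *\<^sub>R i) - k (x - y)) / h) \<midarrow>0\<rightarrow> k' (x - y)"
          using deriv[of "x - y"] by (simp add: DERIV_def)
        then show "(\<lambda>n. (k (x - y + X n *\<^sub>R i) - k (x - y)) / X n) \<longlonglongrightarrow> k' (x - y)"
          using X unfolding tendsto_at_iff_sequentially comp_def by blast
      qed
      show "AE y in lborel. norm ((k (x - y + X n *\<^sub>R i) - k (x - y)) / X n * f y) \<le> B' * \<bar>f y\<bar>" for n
      proof (rule AE_I2)
        fix y
        have "norm ((k (x - y + X n *\<^sub>R i) - k (x - y)) / X n) \<le> B'"
          using Lip[of "x - y" "X n"] X by (simp add: pos_divide_le_eq)
        then show "norm ((k (x - y + X n *\<^sub>R i) - k (x - y)) / X n * f y) \<le> B' * \<bar>f y\<bar>"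
          unfolding real_norm_def abs_mult by (rule mult_right_mono) simp
      qed
    qed (use f in auto)
  qed
  then show ?thesis by (simp add: DERIV_def quot)
qed

text \<open>A partial derivative of the convolution is again a convolution with f, so the
  differentiation step can be repeated. Compact support enters as a source of bounds for the three
  kernels.\<close>

lemma conv_C2:
  fixes k f :: "'a::euclidean_space \<Rightarrow> real"
  assumes k: "continuous_on UNIV k" "\<And>z. norm z > R \<Longrightarrow> k z = 0"
    and k1: "\<And>i. continuous_on UNIV (k1 i)" "\<And>i z. norm z > R \<Longrightarrow> k1 i z = 0"
    and k2: "\<And>i j. continuous_on UNIV (k2 i j)" "\<And>i j z. norm z > R \<Longrightarrow> k2 i j z = 0"
    and d1: "\<And>i z. ((\<lambda>t. k (z + t *\<^sub>R i)) has_real_derivative k1 i z) (at 0)"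
    and d2: "\<And>i j z. ((\<lambda>t. k1 i (z + t *\<^sub>R j)) has_real_derivative k2 i j z) (at 0)"
    and f: "integrable lborel f"
  defines "v \<equiv> \<lambda>x. LINT y|lborel. k (x - y) * f y"
  shows "C2_on UNIV v"
    and "laplacian v x = (LINT y|lborel. (\<Sum>i\<in>Basis. k2 i i (x - y)) * f y)"
proof -
  define v1 where "v1 i x = (LINT y|lborel. k1 i (x - y) * f y)" for i x
  define v2 where "v2 i j x = (LINT y|lborel. k2 i j (x - y) * f y)" for i j x
  obtain B where B: "\<And>z. \<bar>k z\<bar> \<le> B"
    using continuous_compact_support_bounded[OF k] by metis
  have "\<exists>B. \<forall>z. \<bar>k1 i z\<bar> \<le> B" for i
    using continuous_compact_support_bounded[OF k1] by metis
  then obtain B1 where B1: "\<And>i z. \<bar>k1 i z\<bar> \<le> B1 i" by metis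
  have "\<exists>B. \<forall>z. \<bar>k2 i j z\<bar> \<le> B" for i j
    using continuous_compact_support_bounded[OF k2] by metis
  then obtain B2 where B2: "\<And>i j z. \<bar>k2 i j z\<bar> \<le> B2 i j" by metis
  have D1: "((\<lambda>t. v (x + t *\<^sub>R i)) has_real_derivative v1 i x) (at 0)" for i x
    unfolding v_def v1_def by (rule conv_DERIV[OF k(1) B k1(1) B1 d1 f])
  have D2: "((\<lambda>t. v1 i (x + t *\<^sub>R j)) has_real_derivative v2 i j x) (at 0)" for i j x
    unfolding v1_def v2_def by (rule conv_DERIV[OF k1(1) B1 k2(1) B2 d2 f])
  have p1: "partial i v = v1 i" for i
    using partial_eqI[OF D1] by (simp add: fun_eq_iff)
  have p2: "partial j (v1 i) = v2 i j" for i j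
    using partial_eqI[OF D2] by (simp add: fun_eq_iff)
  have "continuous_on UNIV v" "continuous_on UNIV (v1 i)" "continuous_on UNIV (v2 i j)" for i j
    unfolding v_def v1_def[abs_def] v2_def[abs_def]
    using conv_continuous[OF k(1) B f] conv_continuous[OF k1(1) B1 f] conv_continuous[OF k2(1) B2 f]
    by auto
  then show "C2_on UNIV v"
    unfolding C2_on_def has_partial_on_def field_differentiable_def p1 p2
    using D1 D2 by blast
  show "laplacian v x = (LINT y|lborel. (\<Sum>i\<in>Basis. k2 i i (x - y)) * f y)"
    unfolding laplacian_def p1 p2 v2_def sum_distrib_right
    by (rule Bochner_Integration.integral_sum[symmetric]) (rule conv_integrable[OF k2(1) B2 f])
qed

section \<open>The kernel and its derivatives\<close>

lemma DERIV_max_power: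
  "((\<lambda>a::real. max 0 a ^ (n + 2)) has_real_derivative real (n + 2) * max 0 a ^ (n + 1)) (at a)"
proof -
  consider "a > 0" | "a < 0" | "a = 0" by linarith
  then show ?thesis
  proof cases
    case 1
    have "((\<lambda>a::real. a ^ (n + 2)) has_real_derivative real (n + 2) * max 0 a ^ (n + 1)) (at a)"
      using 1 by (intro DERIV_cong[OF DERIV_pow]) simp
    then show ?thesis
      by (rule has_field_derivative_transform_within_open[where S = "{0<..}"]) (use 1 in auto)
  next
    case 2
    have "((\<lambda>a::real. 0) has_real_derivative real (n + 2) * max 0 a ^ (n + 1)) (at a)"
      using 2 by (auto intro!: derivative_eq_intros)
    then show ?thesis
      by (rule has_field_derivative_transform_within_open[where S = "{..<0}"]) (use 2 in auto)
  next
    case 3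
    have "((\<lambda>h::real. max 0 h ^ (n + 1)) \<longlongrightarrow> max 0 0 ^ (n + 1)) (at 0)"
      by (intro tendsto_intros)
    then have "((\<lambda>h::real. max 0 h ^ (n + 1)) \<longlongrightarrow> 0) (at 0)" by simp
    \<comment> \<open>At the kink the difference quotient is \<open>max 0 h ^ (n + 1)\<close> for h
      of either sign, which tends to 0 because the exponent is positive.\<close>
    then have "((\<lambda>h::real. max 0 h ^ (n + 2) / h) \<longlongrightarrow> 0) (at 0)"
      by (rule Lim_transform_eventually)
        (auto simp: eventually_at_filter max_def power2_eq_square intro!: always_eventually)
    then show ?thesis using 3 by (simp add: DERIV_def)
  qed
qed

text \<open>The exponent 3 is the least for which the kernel is twice continuously differentiable.\<close>

definition bump :: "real \<Rightarrow> 'a::euclidean_space \<Rightarrow> real" where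
  "bump R z = max 0 (R\<^sup>2 - z \<bullet> z) ^ 3"

text \<open>The derivative of \<open>bump R\<close> in direction i; \<open>bump2 R i j\<close> is
  that of \<open>bump1 R i\<close> in direction j. With the truncation inside a power, one formula
  is valid on both sides of the sphere |z| = R.\<close>

definition bump1 :: "real \<Rightarrow> 'a::euclidean_space \<Rightarrow> 'a \<Rightarrow> real" where
  "bump1 R i z = - 6 * (z \<bullet> i) * max 0 (R\<^sup>2 - z \<bullet> z) ^ 2"

definition bump2 :: "real \<Rightarrow> 'a::euclidean_space \<Rightarrow> 'a \<Rightarrow> 'a \<Rightarrow> real" where
  "bump2 R i j z = - 6 * (j \<bullet> i) * max 0 (R\<^sup>2 - z \<bullet> z) ^ 2
     + 24 * (z \<bullet> i) * (z \<bullet> j) * max 0 (R\<^sup>2 - z \<bullet> z)"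

lemma DERIV_line_dot:
  fixes z :: "'a::real_inner"
  shows "((\<lambda>t. R\<^sup>2 - (z + t *\<^sub>R i) \<bullet> (z + t *\<^sub>R i)) has_real_derivative - 2 * (z \<bullet> i)) (at 0)"
proof -
  have "(\<lambda>t. R\<^sup>2 - (z + t *\<^sub>R i) \<bullet> (z + t *\<^sub>R i)) =
      (\<lambda>t. R\<^sup>2 - (z \<bullet> z + 2 * t * (z \<bullet> i) + t * t * (i \<bullet> i)))"
    by (simp add: fun_eq_iff inner_add_left inner_add_right inner_commute algebra_simps)
  then show ?thesis
    by (auto intro!: derivative_eq_intros)
qed

lemma DERIV_bump: "((\<lambda>t. bump R (z + t *\<^sub>R i)) has_real_derivative bump1 R i z) (at 0)"
proof -
  have "((\<lambda>t. max 0 (R\<^sup>2 - (z + t *\<^sub>R i) \<bullet> (z + t *\<^sub>R i)) ^ (1 + 2)) has_real_derivative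
      real (1 + 2) * max 0 (R\<^sup>2 - (z + 0 *\<^sub>R i) \<bullet> (z + 0 *\<^sub>R i)) ^ (1 + 1) * (- 2 * (z \<bullet> i))) (at 0)"
    by (rule DERIV_chain2[OF DERIV_max_power DERIV_line_dot])
  then show ?thesis
    unfolding bump_def bump1_def by (simp add: power2_eq_square power3_eq_cube mult_ac)
qed

lemma DERIV_bump1: "((\<lambda>t. bump1 R i (z + t *\<^sub>R j)) has_real_derivative bump2 R i j z) (at 0)"
proof -
  have "((\<lambda>t. max 0 (R\<^sup>2 - (z + t *\<^sub>R j) \<bullet> (z + t *\<^sub>R j)) ^ (0 + 2)) has_real_derivative
      real (0 + 2) * max 0 (R\<^sup>2 - (z + 0 *\<^sub>R j) \<bullet> (z + 0 *\<^sub>R j)) ^ (0 + 1) * (- 2 * (z \<bullet> j))) (at 0)"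
    by (rule DERIV_chain2[OF DERIV_max_power DERIV_line_dot])
  moreover have "((\<lambda>t. - 6 * ((z + t *\<^sub>R j) \<bullet> i)) has_real_derivative - 6 * (j \<bullet> i)) (at 0)"
    unfolding inner_add_left inner_scaleR_left by (auto intro!: derivative_eq_intros)
  ultimately have "((\<lambda>t. - 6 * ((z + t *\<^sub>R j) \<bullet> i) *
      max 0 (R\<^sup>2 - (z + t *\<^sub>R j) \<bullet> (z + t *\<^sub>R j)) ^ (0 + 2)) has_real_derivative
      - 6 * (j \<bullet> i) * max 0 (R\<^sup>2 - (z + 0 *\<^sub>R j) \<bullet> (z + 0 *\<^sub>R j)) ^ (0 + 2) +
      real (0 + 2) * max 0 (R\<^sup>2 - (z + 0 *\<^sub>R j) \<bullet> (z + 0 *\<^sub>R j)) ^ (0 + 1) * (- 2 * (z \<bullet> j)) *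
      (- 6 * ((z + 0 *\<^sub>R j) \<bullet> i))) (at 0)"
    by (rule DERIV_mult[rotated])
  then show ?thesis
    unfolding bump1_def bump2_def by (simp add: power2_eq_square mult_ac)
qed

lemma continuous_bump:
  "continuous_on UNIV (bump R)" "continuous_on UNIV (bump1 R i)" "continuous_on UNIV (bump2 R i j)"
  unfolding bump_def[abs_def] bump1_def[abs_def] bump2_def[abs_def]
  by (intro continuous_intros)+

lemma bump_support:
  assumes "0 \<le> R" "norm z \<ge> R"
  shows "bump R z = 0" "bump1 R i z = 0" "bump2 R i j z = 0"
proof -
  have "max 0 (R\<^sup>2 - z \<bullet> z) = 0"
    using assms by (simp add: dot_square_norm power_mono)
  then show "bump R z = 0" "bump1 R i z = 0" "bump2 R i j z = 0"
    by (simp_all add: bump_def bump1_def bump2_def)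
qed

text \<open>The trace of the second derivatives produces |z|^2, which is rewritten as R^2 - (R^2 -
  |z|^2). As a polynomial in R^2 - |z|^2 without constant term, the Laplacian visibly vanishes on
  the boundary, as \<open>integral_layers\<close> demands of its profile.\<close>

lemma bump_inside:
  fixes z :: "'a::euclidean_space"
  assumes "0 \<le> R" "norm z \<le> R"
  shows "bump R z = (R\<^sup>2 - (norm z)\<^sup>2) ^ 3"
    and "(\<Sum>i\<in>Basis. bump2 R i i z) =
      24 * R\<^sup>2 * (R\<^sup>2 - (norm z)\<^sup>2) - (6 * real DIM('a) + 24) * (R\<^sup>2 - (norm z)\<^sup>2)\<^sup>2"
proof -
  have m: "max 0 (R\<^sup>2 - z \<bullet> z) = R\<^sup>2 - (norm z)\<^sup>2"
    using assms by (simp add: dot_square_norm)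
  show "bump R z = (R\<^sup>2 - (norm z)\<^sup>2) ^ 3"
    by (simp add: bump_def m)
  have "(\<Sum>i\<in>Basis. bump2 R i i z) = (\<Sum>i\<in>Basis. - 6 * (R\<^sup>2 - (norm z)\<^sup>2)\<^sup>2
      + 24 * (R\<^sup>2 - (norm z)\<^sup>2) * ((z \<bullet> i) * (z \<bullet> i)))"
    unfolding bump2_def m by (intro sum.cong) auto
  also have "\<dots> = - 6 * real DIM('a) * (R\<^sup>2 - (norm z)\<^sup>2)\<^sup>2 + 24 * (R\<^sup>2 - (norm z)\<^sup>2) * (norm z)\<^sup>2"
    unfolding sum.distrib sum_distrib_left[symmetric] dot_square_norm[symmetric]
    by (subst (4) euclidean_inner) simp
  finally show "(\<Sum>i\<in>Basis. bump2 R i i z) =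
      24 * R\<^sup>2 * (R\<^sup>2 - (norm z)\<^sup>2) - (6 * real DIM('a) + 24) * (R\<^sup>2 - (norm z)\<^sup>2)\<^sup>2"
    by (simp add: power2_eq_square algebra_simps)
qed

section \<open>From ball mean values to the differential equation\<close>

lemma radial_mean_value:
  fixes x :: "'a::euclidean_space" and u :: "'a \<Rightarrow> real"
  assumes u: "continuous_on D u" "cball x R \<subseteq> D" and "R > 0"
    and mv: "\<And>s. 0 \<le> s \<Longrightarrow> s \<le> R \<Longrightarrow> (LINT y:ball x s|lborel. u y) = G s * u x"
    and w: "continuous_on UNIV w"
    and \<Phi>: "\<And>s. 0 \<le> s \<Longrightarrow> s \<le> R \<Longrightarrow> (\<Phi> has_real_derivative - w s) (at s)" "\<Phi> R = 0"
  shows "(LINT y:ball x R|lborel. \<Phi> (dist x y) * u y) = (LINT s:{0..R}|lborel. w s * G s) * u x"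
proof -
  \<comment> \<open>\<open>integral_layers\<close> asks for integrability on the whole space, so u
    is cut off outside the ball.\<close>
  define f where "f y = indicator (ball x R) y * u y" for y
  have f: "integrable lborel f"
    using cball_integrable[OF u, of "ball x R"] by (auto simp: f_def[abs_def] set_integrable_def)
  have "(LINT y:ball x R|lborel. \<Phi> (dist x y) * u y) = (LINT y:ball x R|lborel. \<Phi> (dist x y) * f y)"
    by (intro set_lebesgue_integral_cong) (auto simp: f_def)
  also have "\<dots> = (LINT s:{0..R}|lborel. w s * (LINT y:ball x s|lborel. f y))"
    by (rule integral_layers[OF f w \<Phi>])
  also have "\<dots> = (LINT s:{0..R}|lborel. w s * G s * u x)"
  proof (rule set_lebesgue_integral_cong, simp, intro allI impI)
    fix s assume s: "s \<in> {0..R}"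
    have "(LINT y:ball x s|lborel. f y) = (LINT y:ball x s|lborel. u y)"
      using s by (intro set_lebesgue_integral_cong) (auto simp: f_def)
    then show "w s * (LINT y:ball x s|lborel. f y) = w s * G s * u x"
      using mv[of s] s by simp
  qed
  also have "\<dots> = (LINT s:{0..R}|lborel. w s * G s) * u x"
    by simp
  finally show ?thesis .
qed

text \<open>The doubled radius leaves room for a kernel of radius R about every point of the smaller
  ball. There the convolution v reproduces u, and the same computation with the Laplacian of the
  kernel gives \<mu>^2 u.\<close>

lemma panharmonic_ball:
  fixes x0 :: "'a::euclidean_space" and u :: "'a \<Rightarrow> real"
  assumes "R > 0" and u: "continuous_on (cball x0 (2 * R)) u"
    and mv: "\<And>x s. x \<in> ball x0 R \<Longrightarrow> 0 < s \<Longrightarrow> s \<le> R \<Longrightarrow>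
      (LINT y:ball x s|lborel. u y) =
        hyp01 (real DIM('a) / 2 + 1) ((\<mu> * s / 2)\<^sup>2) * (unit_ball_vol (real DIM('a)) * s ^ DIM('a)) * u x"
  shows "panharmonic \<mu> (ball x0 R) u"
proof -
  define m where "m = DIM('a)"
  have R0: "0 \<le> R" using \<open>R > 0\<close> by simp
  define G where "G s = hyp01 (real m / 2 + 1) ((\<mu> * s / 2)\<^sup>2) * (unit_ball_vol (real m) * s ^ m)" for s
  \<comment> \<open>Adds the radius 0, where both sides vanish, since the layer integral runs over
    \<open>{0..R}\<close>.\<close>
  have mv': "(LINT y:ball x s|lborel. u y) = G s * u x" if "x \<in> ball x0 R" "0 \<le> s" "s \<le> R" for x s
  proof (cases "s = 0")
    case True
    then show ?thesis by (simp add: G_def m_def set_lebesgue_integral_def zero_power)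
  next
    case False
    then show ?thesis using mv[of x s] that by (simp add: G_def m_def)
  qed
  \<comment> \<open>Minus the derivative of the profile (R^2 - s^2)^3, that is, the weight of the
    ball of radius s in the kernel.\<close>
  define w where "w s = 6 * s * (R\<^sup>2 - s\<^sup>2)\<^sup>2" for s
  define c where "c = (LINT s:{0..R}|lborel. w s * G s)"
  have G_cont: "continuous_on UNIV G"
    unfolding G_def by (intro continuous_intros) auto
  have G_pos: "G s > 0" if "s > 0" for s
    unfolding G_def using that by (intro mult_pos_pos hyp01_pos) auto
  have "c > 0"
  proof -
    let ?g = "\<lambda>s. indicator {0..R} s *\<^sub>R (w s * G s)"
    have "continuous_on {0..R} (\<lambda>s. w s * G s)"
      unfolding w_def by (intro continuous_intros continuous_on_subset[OF G_cont]) auto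
    then have int: "integrable lborel ?g"
      by (intro borel_integrable_compact) auto
    have nonneg: "0 \<le> ?g s" for s
      using G_pos[of s] by (cases "s = 0") (auto simp: indicator_def w_def)
    have "\<not> (AE s in lborel. ?g s = 0)"
    proof
      assume "AE s in lborel. ?g s = 0"
      then have "AE s in lborel. s \<notin> {0<..<R}"
      proof eventually_elim
        case (elim s)
        show ?case
        proof
          assume s: "s \<in> {0<..<R}"
          then have "s\<^sup>2 < R\<^sup>2" by (intro power_strict_mono) auto
          then show False using elim s G_pos[of s] by (simp add: w_def)
        qed
      qed
      then have "emeasure lborel {0<..<R} = 0"
        using AE_iff_null_sets[of "{0<..<R}" lborel] by auto
      then show False using \<open>R > 0\<close> by simp
    qed
    then have "c \<noteq> 0"
      unfolding c_def set_lebesgue_integral_def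
      using integral_nonneg_eq_0_iff_AE[OF int] nonneg by auto
    moreover have "c \<ge> 0"
      unfolding c_def set_lebesgue_integral_def using nonneg by (intro integral_nonneg_AE) auto
    ultimately show ?thesis by simp
  qed
  \<comment> \<open>The cut-off makes u integrable on the whole space, and dividing by c normalises
    the convolution so that it reproduces u itself.\<close>
  define f where "f y = indicator (cball x0 (2 * R)) y * u y / c" for y
  have f: "integrable lborel f"
    using borel_integrable_compact[OF compact_cball u] by (simp add: f_def[abs_def])
  define v where "v x = (LINT y|lborel. bump R (x - y) * f y)" for x
  have supp: "\<And>z. norm z > R \<Longrightarrow> bump R z = 0" "\<And>i z. norm z > R \<Longrightarrow> bump1 R i z = 0"
    "\<And>i j z. norm z > R \<Longrightarrow> bump2 R i j z = 0"
    by (simp_all add: bump_support[OF R0])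
  have C2: "C2_on UNIV v" "laplacian v x = (LINT y|lborel. (\<Sum>i\<in>Basis. bump2 R i i (x - y)) * f y)" for x
    unfolding v_def[abs_def]
    by (rule conv_C2[where R = R and ?k1.0 = "bump1 R" and ?k2.0 = "bump2 R"];
        (rule continuous_bump supp DERIV_bump DERIV_bump1 f | assumption)+)+
  have radial: "(LINT y|lborel. k (x - y) * f y) = (LINT s:{0..R}|lborel. w' s * G s) * u x / c"
    if x: "x \<in> ball x0 R"
      and k: "\<And>z. norm z < R \<Longrightarrow> k z = \<Phi> (norm z)" "\<And>z. norm z \<ge> R \<Longrightarrow> k z = 0"
      and w': "continuous_on UNIV w'"
      and \<Phi>: "\<And>s. (\<Phi> has_real_derivative - w' s) (at s)" "\<Phi> R = 0" for x k \<Phi> w'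
  proof -
    have sub: "cball x R \<subseteq> cball x0 (2 * R)"
    proof
      fix y assume "y \<in> cball x R"
      then show "y \<in> cball x0 (2 * R)"
        using dist_triangle[of x0 y x] x by simp
    qed
    have "(LINT y|lborel. k (x - y) * f y) = (LINT y:ball x R|lborel. \<Phi> (dist x y) * u y) / c"
      unfolding set_lebesgue_integral_def integral_divide_zero[symmetric]
    proof (intro Bochner_Integration.integral_cong refl)
      fix y
      show "k (x - y) * f y = indicator (ball x R) y *\<^sub>R (\<Phi> (dist x y) * u y) / c"
      proof (cases "dist x y < R")
        case True
        then have "y \<in> cball x0 (2 * R)" by (intro subsetD[OF sub]) simp
        then show ?thesis using True k(1)[of "x - y"] by (simp add: f_def dist_norm)
      next
        case False
        then show ?thesis using k(2)[of "x - y"] by (simp add: dist_norm)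
      qed
    qed
    also have "(LINT y:ball x R|lborel. \<Phi> (dist x y) * u y) = (LINT s:{0..R}|lborel. w' s * G s) * u x"
      by (rule radial_mean_value[OF u sub \<open>R > 0\<close> _ w']) (rule mv'[OF x] \<Phi> | assumption)+
    finally show ?thesis .
  qed
  have v: "v x = u x" if "x \<in> ball x0 R" for x
  proof -
    have "v x = (LINT s:{0..R}|lborel. w s * G s) * u x / c"
      unfolding v_def
    proof (rule radial[of x "bump R" "\<lambda>s. (R\<^sup>2 - s\<^sup>2) ^ 3", OF that])
      show "bump R z = (R\<^sup>2 - (norm z)\<^sup>2) ^ 3" if "norm z < R" for z :: 'a
        using that R0 by (intro bump_inside) auto
      show "((\<lambda>s. (R\<^sup>2 - s\<^sup>2) ^ 3) has_real_derivative - w s) (at s)" for s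
        unfolding w_def by (auto intro!: derivative_eq_intros)
    qed (auto simp: w_def bump_support(1)[OF R0] intro!: continuous_intros)
    then show ?thesis
      unfolding c_def[symmetric] using \<open>c > 0\<close> by simp
  qed
  have lap: "laplacian v x = \<mu>\<^sup>2 * u x" if "x \<in> ball x0 R" for x
  proof -
    \<comment> \<open>Minus the derivative of the radial profile of the Laplacian in
      \<open>bump_inside\<close>.\<close>
    let ?w = "\<lambda>s. 48 * R\<^sup>2 * s - 4 * (6 * real m + 24) * s * (R\<^sup>2 - s\<^sup>2)"
    have "laplacian v x = (LINT s:{0..R}|lborel. ?w s * G s) * u x / c"
      unfolding C2(2)
    proof (rule radial[of x "\<lambda>z. \<Sum>i\<in>Basis. bump2 R i i z"
          "\<lambda>s. 24 * R\<^sup>2 * (R\<^sup>2 - s\<^sup>2) - (6 * real m + 24) * (R\<^sup>2 - s\<^sup>2)\<^sup>2", OF that])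
      show "(\<Sum>i\<in>Basis. bump2 R i i z) =
          24 * R\<^sup>2 * (R\<^sup>2 - (norm z)\<^sup>2) - (6 * real m + 24) * (R\<^sup>2 - (norm z)\<^sup>2)\<^sup>2"
        if "norm z < R" for z :: 'a
        unfolding m_def using that R0 by (intro bump_inside) auto
      show "((\<lambda>s. 24 * R\<^sup>2 * (R\<^sup>2 - s\<^sup>2) - (6 * real m + 24) * (R\<^sup>2 - s\<^sup>2)\<^sup>2)
          has_real_derivative - ?w s) (at s)" for s
        by (auto intro!: derivative_eq_intros)
    qed (auto simp: bump_support(3)[OF R0] intro!: continuous_intros)
    also have "(LINT s:{0..R}|lborel. ?w s * G s) = \<mu>\<^sup>2 * c"
      unfolding c_def w_def G_def by (rule radial_integrals[OF R0])
    finally show ?thesis using \<open>c > 0\<close> by simp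
  qed
  have "C2_on (ball x0 R) v"
    using C2(1) unfolding C2_on_def has_partial_on_def by (blast intro: continuous_on_subset)
  then have "panharmonic \<mu> (ball x0 R) v"
    using v lap unfolding panharmonic_def by simp
  then show ?thesis
    using panharmonic_cong[of "ball x0 R" v u \<mu>] v by simp
qed

text \<open>The converse of the mean value theorem for balls, reduced to small balls on which the
  kernel argument has enough room.\<close>

lemma panharmonic_ball_mean_value:
  fixes D :: "'a::euclidean_space set" and u :: "'a \<Rightarrow> real"
  assumes "open D" and u: "continuous_on D u"
    and mv: "\<And>x s. x \<in> D \<Longrightarrow> 0 < s \<Longrightarrow> cball x s \<subseteq> D \<Longrightarrow> (LINT y:ball x s|lborel. u y) =
      hyp01 (real DIM('a) / 2 + 1) ((\<mu> * s / 2)\<^sup>2) * (unit_ball_vol (real DIM('a)) * s ^ DIM('a)) * u x"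
  shows "panharmonic \<mu> D u"
proof (rule panharmonic_local)
  fix x0 assume "x0 \<in> D"
  then obtain e where "e > 0" "cball x0 e \<subseteq> D"
    using \<open>open D\<close> unfolding open_contains_cball by blast
  then obtain R where R: "R > 0" "cball x0 (2 * R) \<subseteq> D"
    using that[of "e / 2"] by simp
  have "panharmonic \<mu> (ball x0 R) u"
  proof (rule panharmonic_ball[OF R(1)])
    show "continuous_on (cball x0 (2 * R)) u"
      using u R(2) by (rule continuous_on_subset)
    fix x s assume x: "x \<in> ball x0 R" and s: "0 < s" "s \<le> R"
    have "cball x s \<subseteq> cball x0 (2 * R)"
    proof
      fix y assume "y \<in> cball x s"
      then show "y \<in> cball x0 (2 * R)"
        using dist_triangle[of x0 y x] x s by simp
    qed
    then have sub: "cball x s \<subseteq> D" using R(2) by blast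
    then have "x \<in> D" using s by auto
    then show "(LINT y:ball x s|lborel. u y) =
        hyp01 (real DIM('a) / 2 + 1) ((\<mu> * s / 2)\<^sup>2) * (unit_ball_vol (real DIM('a)) * s ^ DIM('a)) * u x"
      using s(1) sub by (rule mv)
  qed
  then show "\<exists>S. open S \<and> x0 \<in> S \<and> panharmonic \<mu> S u"
    using R(1) by (intro exI[of _ "ball x0 R"]) auto
qed

theorem theorem4p3:
  fixes D :: "'a::euclidean_space set" and u :: "'a \<Rightarrow> real" and \<mu> :: real
  assumes "DIM('a) \<ge> 2"
    and "open D" and "connected D" and "bounded D"
    and "\<mu> > 0"
    and "continuous_on D u"
    and "(\<forall>x\<in>D. \<forall>r1 r2. 0 < r1 \<and> r1 < r2 \<and> cball x r2 \<subseteq> D \<longrightarrow>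
              (\<forall>r\<in>{r1<..<r2}. MV_identity \<mu> u x r1 r2 r))
       \<or> (\<forall>x\<in>D. \<forall>r1 r2. 0 < r1 \<and> r1 < r2 \<and> cball x r2 \<subseteq> D \<longrightarrow> MV_identity \<mu> u x r1 r2 r1)
       \<or> (\<forall>x\<in>D. \<forall>r1 r2. 0 < r1 \<and> r1 < r2 \<and> cball x r2 \<subseteq> D \<longrightarrow> MV_identity \<mu> u x r1 r2 r2)"
  shows "panharmonic \<mu> D u"
  using assms(2,6) ball_mean_value[OF assms(1,2,5,6,7)] by (rule panharmonic_ball_mean_value)

end
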